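(* Let $t>0$ be an integer. There is a constant $C_t$ such that the following holds. Let $P$ be a star-shaped polygon and let $V$ be a set of $n$ points on its boundary. If the visibility graph of $V$ with respect to $P$ does not contain $K_{t,t}$ as a subgraph, then it has at most $C_t n$ edges.
   Context: A simple polygon $P$ is star-shaped if it contains a point that sees every point of $P$. Two points $p,q\in P$ see each other (are mutually visible) if the segment $\overline{pq}$ is disjoint from the exterior of $P$. The visibility graph of a set $V$ of points on the boundary of $P$ with respect to $P$ has vertex set $V$, with two points adjacent iff they are mutually visible. *)

theory Defs
  imports "HOL-Analysis.Analysis"
begin

fun polygonal_path :: "complex list \<Rightarrow> real \<Rightarrow> complex" where
  "polygonal_path [] = linepath 0 0"
| "polygonal_path [a] = linepath a a"
| "polygonal_path [a, b] = linepath a b"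
| "polygonal_path (a # b # c # xs) = linepath a b +++ polygonal_path (b # c # xs)"

definition polygon_curve :: "complex list \<Rightarrow> real \<Rightarrow> complex" where
  "polygon_curve vs = polygonal_path (vs @ [hd vs])"

definition simple_polygon :: "complex list \<Rightarrow> bool" where
  "simple_polygon vs \<longleftrightarrow> length vs \<ge> 3 \<and> simple_path (polygon_curve vs)"

definition polygon_boundary :: "complex list \<Rightarrow> complex set" where
  "polygon_boundary vs = path_image (polygon_curve vs)"

definition polygon_region :: "complex list \<Rightarrow> complex set" where
  "polygon_region vs = polygon_boundary vs \<union> inside (polygon_boundary vs)"

definition sees :: "complex list \<Rightarrow> complex \<Rightarrow> complex \<Rightarrow> bool" where
  "sees vs p q \<longleftrightarrow> closed_segment p q \<subseteq> polygon_region vs"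

definition star_shaped_polygon :: "complex list \<Rightarrow> bool" where
  "star_shaped_polygon vs \<longleftrightarrow>
     (\<exists>p \<in> polygon_region vs. \<forall>q \<in> polygon_region vs. sees vs p q)"

definition vis_edges :: "complex list \<Rightarrow> complex set \<Rightarrow> complex set set" where
  "vis_edges vs V = {{p, q} | p q. p \<in> V \<and> q \<in> V \<and> p \<noteq> q \<and> sees vs p q}"

definition vis_contains_Ktt :: "complex list \<Rightarrow> complex set \<Rightarrow> nat \<Rightarrow> bool" where
  "vis_contains_Ktt vs V t \<longleftrightarrow>
     (\<exists>A B. A \<subseteq> V \<and> B \<subseteq> V \<and> A \<inter> B = {} \<and> card A = t \<and> card B = t \<and>
            (\<forall>a\<in>A. \<forall>b\<in>B. sees vs a b))"

end

theory Submission
  imports Defs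
begin

text \<open>
  Put the centre of the polygon at the origin. At most \<open>2 t\<close> points of \<open>V\<close> lie on a line through the
  centre, since they all see each other; this bounds the collinear pairs. Every other visible pair
  is oriented \<open>(u, v)\<close> with \<open>v\<close> counterclockwise of \<open>u\<close> by less than \<open>\<pi>\<close>. If \<open>x, u, v, w\<close> are in
  counterclockwise order within an angle less than \<open>\<pi>\<close>, and \<open>x\<close> sees \<open>v\<close> and \<open>u\<close> sees \<open>w\<close>, then \<open>x\<close> sees \<open>w\<close>:
  \<open>u\<close> and \<open>v\<close> are boundary points, so they are not inside the visible triangles \<open>0xv\<close> and \<open>0uw\<close>, and
  therefore \<open>xw\<close> lies within the union of these triangles.

  Fix two opposite half-planes. For pairs inside one half-plane, delete the \<open>t\<close> farthest successors
  and the \<open>t\<close> farthest predecessors of every point; if a pair \<open>(u, v)\<close> were left, then \<open>t\<close> deleted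
  predecessors of \<open>v\<close> would see \<open>t\<close> deleted successors of \<open>u\<close>. For pairs from one half-plane to
  the other, reflect the second points in the centre; the pairs then form, in essence, an intersection graph of
  horizontal and vertical segments grounded on the diagonal, and a sweep bounds the number of
  edges of such a graph when it has no \<open>K\<^sub>t\<^sub>,\<^sub>t\<close>.
\<close>

section \<open>Edge bounds for relations without a large biclique\<close>

definition biclique_free :: "nat \<Rightarrow> ('a \<times> 'b) set \<Rightarrow> bool" where
  "biclique_free t E \<longleftrightarrow> \<not> (\<exists>X Y. card X = t \<and> card Y = t \<and> X \<times> Y \<subseteq> E)"

lemma biclique_freeD:
  assumes "biclique_free t E" "finite X" "finite Y" "t \<le> card X" "t \<le> card Y"
    "\<And>x y. x \<in> X \<Longrightarrow> y \<in> Y \<Longrightarrow> (x, y) \<in> E"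
  shows False
proof -
  obtain X' where X': "X' \<subseteq> X" "card X' = t"
    using assms(4) obtain_subset_with_card_n by metis
  obtain Y' where Y': "Y' \<subseteq> Y" "card Y' = t"
    using assms(5) obtain_subset_with_card_n by metis
  have "X' \<times> Y' \<subseteq> E" using X' Y' assms(6) by blast
  then show False using assms(1) X' Y' unfolding biclique_free_def by blast
qed

text \<open>The number of elements of \<open>N\<close> above \<open>v\<close> strictly decreases as
  \<open>g v\<close> grows. It is therefore injective on \<open>N\<close> and takes each value below
  \<open>t\<close> at most once.\<close>

lemma card_few_above_le:
  fixes g :: "'a \<Rightarrow> real"
  assumes "finite N" "inj_on g N"
  shows "card {v \<in> N. card {w \<in> N. g v < g w} < t} \<le> t"
proof -
  define rk where "rk v = card {w \<in> N. g v < g w}" for v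
  have less: "rk v' < rk v" if "v' \<in> N" "g v < g v'" for v v'
    unfolding rk_def
  proof (rule psubset_card_mono)
    show "finite {w \<in> N. g v < g w}" using assms by simp
    show "{w \<in> N. g v' < g w} \<subset> {w \<in> N. g v < g w}" using that by force
  qed
  have "inj_on rk N"
  proof (rule inj_onI, rule ccontr)
    fix v v' assume h: "v \<in> N" "v' \<in> N" "rk v = rk v'" "v \<noteq> v'"
    then have "g v < g v' \<or> g v' < g v" using assms(2) by (metis inj_onD linorder_neqE)
    then show False using less h by (metis less_irrefl)
  qed
  then have "inj_on rk {v \<in> N. rk v < t}" by (rule inj_on_subset) auto
  then have "card {v \<in> N. rk v < t} \<le> card {..<t}"
    by (rule card_inj_on_le) auto
  then show ?thesis by (simp add: rk_def)
qed

lemma card_le_of_Sigma: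
  assumes "finite A" "\<And>u. u \<in> A \<Longrightarrow> finite (F u) \<and> card (F u) \<le> k" "E \<subseteq> Sigma A F"
  shows "card E \<le> k * card A"
proof -
  have "card E \<le> card (Sigma A F)"
    using assms by (intro card_mono finite_SigmaI) auto
  also have "\<dots> = (\<Sum>u\<in>A. card (F u))"
    using assms by (intro card_SigmaI) auto
  also have "\<dots> \<le> card A * k"
    using sum_bounded_above[of A "\<lambda>u. card (F u)" k] assms by simp
  finally show ?thesis by (simp add: mult.commute)
qed

lemma card_few_right_le:
  fixes g :: "'b \<Rightarrow> real"
  assumes "finite A" "finite B" "inj_on g B" "E \<subseteq> A \<times> B"
  shows "card {(u, v) \<in> E. card {w. (u, w) \<in> E \<and> g v < g w} < t} \<le> t * card A"
proof (rule card_le_of_Sigma[OF assms(1)])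
  let ?N = "\<lambda>u. {w. (u, w) \<in> E}"
  let ?F = "\<lambda>u. {v \<in> ?N u. card {w \<in> ?N u. g v < g w} < t}"
  show "finite (?F u) \<and> card (?F u) \<le> t" if "u \<in> A" for u
  proof -
    have sub: "?N u \<subseteq> B" using assms(4) by auto
    then have fin: "finite (?N u)" using assms(2) finite_subset by blast
    then show ?thesis
      using card_few_above_le[OF fin inj_on_subset[OF assms(3) sub]] by auto
  qed
  show "{(u, v) \<in> E. card {w. (u, w) \<in> E \<and> g v < g w} < t} \<subseteq> Sigma A ?F"
    using assms(4) by auto
qed

lemma card_few_left_le:
  fixes f :: "'a \<Rightarrow> real"
  assumes "finite A" "finite B" "inj_on f A" "E \<subseteq> A \<times> B"
  shows "card {(u, v) \<in> E. card {x. (x, v) \<in> E \<and> f x < f u} < t} \<le> t * card B"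
proof -
  let ?D = "{(u, v) \<in> E. card {x. (x, v) \<in> E \<and> f x < f u} < t}"
  have inj: "inj_on (\<lambda>x. - f x) A" using assms(3) by (simp add: inj_on_def)
  have sub: "E\<inverse> \<subseteq> B \<times> A" using assms(4) by auto
  have "{(v, u) \<in> E\<inverse>. card {x. (v, x) \<in> E\<inverse> \<and> - f u < - f x} < t} = ?D\<inverse>" by auto
  then have "card (?D\<inverse>) \<le> t * card B"
    using card_few_right_le[OF assms(2,1) inj sub, of t] by simp
  then show ?thesis by simp
qed

text \<open>If both \<open>t\<close> points \<open>x\<close> before \<open>u\<close> are joined to
  \<open>v\<close> and \<open>t\<close> points \<open>w\<close> after \<open>v\<close> are joined to
  \<open>u\<close>, then \<open>cross\<close> makes these points a biclique. So every edge is among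
  the last \<open>t\<close> at its first endpoint or the first \<open>t\<close> at its second. The
  orders \<open>f\<close> and \<open>g\<close> are independent, which lets ties be broken
  differently for the two endpoints.\<close>

lemma crossing_closed_card_le:
  fixes f :: "'a \<Rightarrow> real" and g :: "'b \<Rightarrow> real"
  assumes fin: "finite A" "finite B" and inj: "inj_on f A" "inj_on g B" and E: "E \<subseteq> A \<times> B"
    and free: "biclique_free t E"
    and cross: "\<And>x u v w. (x, v) \<in> E \<Longrightarrow> (u, v) \<in> E \<Longrightarrow> (u, w) \<in> E \<Longrightarrow>
                  f x < f u \<Longrightarrow> g v < g w \<Longrightarrow> (x, w) \<in> E"
  shows "card E \<le> t * card A + t * card B"
proof -
  let ?R = "\<lambda>u v. {w. (u, w) \<in> E \<and> g v < g w}"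
  let ?L = "\<lambda>u v. {x. (x, v) \<in> E \<and> f x < f u}"
  let ?E1 = "{(u, v) \<in> E. card (?R u v) < t}" and ?E2 = "{(u, v) \<in> E. card (?L u v) < t}"
  have finE: "finite E" using E fin finite_subset by blast
  have "E \<subseteq> ?E1 \<union> ?E2"
  proof (rule subsetI, rule ccontr)
    fix e assume e: "e \<in> E" "e \<notin> ?E1 \<union> ?E2"
    obtain u v where uv: "e = (u, v)" by fastforce
    have "(u, v) \<in> E" "t \<le> card (?R u v)" "t \<le> card (?L u v)" using e uv by auto
    moreover have "finite (?L u v)" "finite (?R u v)"
      using E fin by (auto intro: finite_subset[of _ A] finite_subset[of _ B])
    ultimately show False
      using biclique_freeD[OF free, of "?L u v" "?R u v"] cross by blast
  qed
  then have "card E \<le> card (?E1 \<union> ?E2)"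
    by (intro card_mono finite_UnI) (auto intro: finite_subset[OF _ finE])
  also have "\<dots> \<le> card ?E1 + card ?E2" by (rule card_Un_le)
  also have "\<dots> \<le> t * card A + t * card B"
    using card_few_right_le[OF fin inj(2) E] card_few_left_le[OF fin inj(1) E] by (rule add_mono)
  finally show ?thesis .
qed

text \<open>Repeatedly add a minimum of what remains. This supplies the \<open>t\<close> neighbours
  of a vertex that lie directly above an edge.\<close>

lemma obtain_lowest_subset:
  fixes f :: "'a \<Rightarrow> real"
  assumes "finite U" "t \<le> card U"
  shows "\<exists>T \<subseteq> U. card T = t \<and> (\<forall>a\<in>T. \<forall>a'\<in>U. f a' < f a \<longrightarrow> a' \<in> T)"
  using assms(2)
proof (induction t)
  case 0
  show ?case by (intro exI[of _ "{}"]) auto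
next
  case (Suc t)
  then obtain T where T: "T \<subseteq> U" "card T = t" "\<forall>a\<in>T. \<forall>a'\<in>U. f a' < f a \<longrightarrow> a' \<in> T"
    by auto
  have finT: "finite T" using T(1) assms(1) finite_subset by blast
  have "U - T \<noteq> {}" using T Suc.prems card_mono[OF finT, of U] by auto
  then obtain m where m: "m \<in> U - T" "\<forall>a\<in>U - T. f m \<le> f a"
    using arg_min_if_finite(1)[of "U - T" f] arg_min_least[of "U - T" _ f] assms(1) by blast
  show ?case
  proof (intro exI[of _ "insert m T"] conjI)
    show "insert m T \<subseteq> U" using m T by auto
    show "card (insert m T) = Suc t" using m T finT by simp
    show "\<forall>a\<in>insert m T. \<forall>a'\<in>U. f a' < f a \<longrightarrow> a' \<in> insert m T"
    proof (intro ballI impI)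
      fix a a' assume "a \<in> insert m T" "a' \<in> U" "f a' < f a"
      then show "a' \<in> insert m T" using m(2) T(3) by (cases "a = m") force+
    qed
  qed
qed

text \<open>With \<open>r b\<close> the position of the last neighbour of \<open>b\<close>, the hypothesis says that \<open>E\<close> is, up to
  the lowest neighbour of each \<open>c\<close>, the intersection graph of the horizontal segments
  from \<open>(f b, f b)\<close> to \<open>(r b, f b)\<close> with vertical segments hanging down from \<open>(g c, g c)\<close>.
  An edge with many edges above it and to its right is charged to the first of the \<open>t\<close>
  horizontal segments directly above it that ends.\<close>

lemma hook_graph_card_le:
  fixes f :: "'a \<Rightarrow> real" and g :: "'b \<Rightarrow> real"
  assumes fin: "finite B" "finite C" and inj: "inj_on f B" "inj_on g C" and E: "E \<subseteq> B \<times> C"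
    and less: "\<And>b c. (b, c) \<in> E \<Longrightarrow> f b < g c"
    and free: "biclique_free t E" and t: "t > 0"
    and hook: "\<And>a b c d. (a, c) \<in> E \<Longrightarrow> (b, d) \<in> E \<Longrightarrow> f a < f b \<Longrightarrow> f b < g c \<Longrightarrow>
                  g c < g d \<Longrightarrow> (b, c) \<in> E"
  shows "card E \<le> t * card B + t * card C + t * t * card B"
proof -
  define r where "r b = Max (g ` {d. (b, d) \<in> E})" for b
  have finN: "finite {d. (b, d) \<in> E}" for b
    using E fin by (auto intro: finite_subset[of _ C])
  have finM: "finite {a. (a, c) \<in> E}" for c
    using E fin by (auto intro: finite_subset[of _ B])
  have r_ge: "g d \<le> r b" if "(b, d) \<in> E" for b d
    unfolding r_def using finN that by (intro Max_ge) auto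
  have r_attained: "\<exists>d. (b, d) \<in> E \<and> g d = r b" if "(b, c) \<in> E" for b c
  proof -
    have "r b \<in> g ` {d. (b, d) \<in> E}"
      unfolding r_def using finN that by (intro Max_in) auto
    then show ?thesis by auto
  qed
  \<comment> \<open>A horizontal segment \<open>b\<close> that has started and not ended at position
    \<open>g c\<close> meets the vertical of \<open>c\<close>, provided that the vertical reaches
    down to some \<open>a\<close> below \<open>b\<close>. If \<open>b\<close> ends exactly there,
    \<open>c\<close> is its last neighbour by injectivity of \<open>g\<close>; otherwise
    \<open>hook\<close> applies with that last neighbour.\<close>
  have active: "(b, c) \<in> E"
    if "(a, c) \<in> E" "f a < f b" "f b < g c" "(b, d) \<in> E" "g c \<le> r b" for a b c d
  proof -
    obtain e where e: "(b, e) \<in> E" "g e = r b" using r_attained \<open>(b, d) \<in> E\<close> by blast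
    show ?thesis
    proof (cases "g c = g e")
      case True
      then have "c = e" using inj_onD[OF inj(2), of c e] e that(1) E by blast
      then show ?thesis using e by simp
    next
      case False
      then show ?thesis using hook[of a c b e] that e by auto
    qed
  qed
  let ?R = "\<lambda>b c. {d. (b, d) \<in> E \<and> g c < g d}"
  let ?U = "\<lambda>b c. {a. (a, c) \<in> E \<and> f b < f a}"
  let ?E1 = "{(b, c) \<in> E. card (?R b c) < t}" and ?E2 = "{(b, c) \<in> E. card (?U b c) < t}"
  let ?E3 = "E - ?E1 - ?E2"
  define S where "S a = {b. b \<in> fst ` E \<and> f b < f a \<and> r a \<le> r b}" for a
  define P where "P a = {b \<in> S a. card {b' \<in> S a. f b < f b'} < t}" for a
  define M where "M a b = {d. (b, d) \<in> E \<and> g d \<le> r a}" for a b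
  define Q where "Q a b = {c \<in> M a b. card {d \<in> M a b. g c < g d} < t}" for a b
  have SB: "S a \<subseteq> B" for a using E by (auto simp: S_def)
  then have finS: "finite (S a)" for a using fin finite_subset by blast
  have finP: "finite (P a)" for a using finS by (simp add: P_def)
  have finMM: "finite (M a b)" for a b using finN[of b] by (simp add: M_def)
  have cardP: "card (P a) \<le> t" for a
    unfolding P_def using finS by (intro card_few_above_le inj_on_subset[OF inj(1)]) (use SB in auto)
  have cardQ: "card (Q a b) \<le> t" for a b
    unfolding Q_def using finMM E
    by (intro card_few_above_le inj_on_subset[OF inj(2)]) (auto simp: M_def)
  have charge: "\<exists>a\<in>B. b \<in> P a \<and> c \<in> Q a b" if e: "(b, c) \<in> ?E3" for b c
  proof -
    have bc: "(b, c) \<in> E" and Rt: "t \<le> card (?R b c)" and Ut: "t \<le> card (?U b c)"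
      using e by auto
    have finU: "finite (?U b c)" using finM[of c] by simp
    obtain T where T: "T \<subseteq> ?U b c" "card T = t" "\<forall>a\<in>T. \<forall>a'\<in>?U b c. f a' < f a \<longrightarrow> a' \<in> T"
      using obtain_lowest_subset[OF finU Ut, of f] by blast
    have finT: "finite T" "T \<noteq> {}" using T finU t finite_subset by (blast, auto)
    define a where "a = arg_min_on r T"
    have aT: "a \<in> T" and amin: "\<And>a'. a' \<in> T \<Longrightarrow> r a \<le> r a'"
      unfolding a_def using finT by (auto intro: arg_min_if_finite arg_min_least)
    have ac: "(a, c) \<in> E" "f b < f a" using aT T by auto
    let ?D = "{d. (b, d) \<in> E \<and> g c < g d \<and> g d \<le> r a}"
    have finD: "finite ?D" using finN[of b] by simp
    \<comment> \<open>All of \<open>T\<close> is still active up to \<open>r a\<close>, so each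
      \<open>d\<close> in \<open>?D\<close> is joined to all of \<open>T\<close>; \<open>t\<close>
      such \<open>d\<close> would complete a biclique.\<close>
    have D: "card ?D < t"
    proof (rule ccontr)
      assume "\<not> card ?D < t"
      moreover have "(a', d) \<in> E" if "a' \<in> T" "d \<in> ?D" for a' d
      proof -
        have "(a', c) \<in> E" "f b < f a'" using T that by auto
        then show ?thesis
          using active[of b d a' c] less[of a' c] amin[of a'] that by auto
      qed
      ultimately show False
        using biclique_freeD[OF free finT(1) finD] T(2) by auto
    qed
    \<comment> \<open>If \<open>b\<close> ended before \<open>a\<close>, then all its neighbours
      beyond \<open>c\<close> would lie in \<open>?D\<close>, which has too few elements.\<close>
    have rb: "r a \<le> r b"
    proof (rule ccontr)
      assume "\<not> r a \<le> r b"
      then have "?R b c = ?D" using r_ge by fastforce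
      then show False using D Rt by simp
    qed
    have "b \<in> S a" using bc ac rb by (force simp: S_def)
    moreover have "card {b' \<in> S a. f b < f b'} < t"
    proof -
      \<comment> \<open>A segment between \<open>b\<close> and \<open>a\<close> in height that does
        not end before \<open>a\<close> is active at \<open>c\<close>. Since \<open>T\<close> is
        closed downwards among the neighbours of \<open>c\<close> above \<open>b\<close>, it
        contains this segment; leaving out \<open>a\<close> makes the count strictly less than
        \<open>t\<close>.\<close>
      have "b' \<in> T - {a}" if b': "b' \<in> S a" "f b < f b'" for b'
      proof -
        have h: "f b' < f a" "r a \<le> r b'" using b' by (auto simp: S_def)
        obtain d where "(b', d) \<in> E" using b' by (auto simp: S_def)
        moreover have "f b' < g c" using h less[OF ac(1)] by simp
        moreover have "g c \<le> r b'" using h r_ge[OF ac(1)] by simp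
        ultimately have "(b', c) \<in> E" using active[OF bc b'(2)] by blast
        then show ?thesis using T(3) aT h b' by auto
      qed
      then have "card {b' \<in> S a. f b < f b'} \<le> card (T - {a})"
        using finT by (intro card_mono) auto
      also have "\<dots> < t" using aT finT T(2) t by (simp add: card_Diff_singleton)
      finally show ?thesis .
    qed
    ultimately have "b \<in> P a" by (simp add: P_def)
    moreover have "c \<in> Q a b"
    proof -
      have "{d \<in> M a b. g c < g d} = ?D" by (auto simp: M_def)
      then show ?thesis using D bc r_ge[OF ac(1)] by (simp add: Q_def M_def)
    qed
    moreover have "a \<in> B" using ac E by auto
    ultimately show ?thesis by blast
  qed
  have finE: "finite E" using E fin finite_subset by blast
  let ?W = "Sigma B (\<lambda>a. Sigma (P a) (Q a))"
  have "card ?W \<le> (t * t) * card B"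
  proof (rule card_le_of_Sigma[OF fin(1) _ subset_refl])
    fix a
    have finQ: "finite (Q a b)" for b using finMM by (simp add: Q_def)
    have "card (Sigma (P a) (Q a)) \<le> t * card (P a)"
      using finP cardQ finQ by (intro card_le_of_Sigma[OF _ _ subset_refl]) auto
    also have "\<dots> \<le> t * t" using cardP by simp
    finally show "finite (Sigma (P a) (Q a)) \<and> card (Sigma (P a) (Q a)) \<le> t * t"
      using finP finQ by auto
  qed
  moreover have "card ?E3 \<le> card ?W"
  proof (rule surj_card_le[where f = snd])
    show "finite ?W" using finP finMM fin by (auto simp: Q_def)
    show "?E3 \<subseteq> snd ` ?W" using charge by force
  qed
  ultimately have E3: "card ?E3 \<le> t * t * card B" by linarith
  have E1: "card ?E1 \<le> t * card B" by (rule card_few_right_le[OF fin inj(2) E])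
  have E2: "card ?E2 \<le> t * card C"
    using card_few_left_le[OF fin _ E, of "\<lambda>x. - f x" t] inj(1) by (simp add: inj_on_def)
  have "card E \<le> card (?E1 \<union> ?E2 \<union> ?E3)"
    by (intro card_mono finite_UnI) (auto intro: finite_subset[OF _ finE])
  also have "\<dots> \<le> card ?E1 + card ?E2 + card ?E3"
    by (meson add_le_mono1 card_Un_le order_trans)
  finally show ?thesis using E1 E2 E3 by linarith
qed


lemma biclique_free_mono: "biclique_free t F \<Longrightarrow> E \<subseteq> F \<Longrightarrow> biclique_free t E"
  unfolding biclique_free_def by blast

section \<open>Segments in a set that is star-shaped about the origin\<close>

text \<open>Twice the signed area of the triangle \<open>0\<close>, \<open>p\<close>,
  \<open>q\<close>: positive iff \<open>q\<close> is counterclockwise of \<open>p\<close> by an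
  angle strictly between \<open>0\<close> and \<open>pi\<close>.\<close>

definition cross2 :: "complex \<Rightarrow> complex \<Rightarrow> real" where
  "cross2 p q = Re p * Im q - Im p * Re q"

lemma cross2_rcis: "cross2 (rcis r a) (rcis s b) = r * s * sin (b - a)"
  by (simp add: cross2_def sin_diff algebra_simps)

lemma cross2_cramer:
  assumes "cross2 x v \<noteq> 0"
  shows "z = (cross2 z v / cross2 x v) *\<^sub>R x + (cross2 x z / cross2 x v) *\<^sub>R v"
  using assms by (auto simp: complex_eq_iff cross2_def divide_simps) (simp_all add: algebra_simps)

definition star_at_0 :: "complex set \<Rightarrow> bool" where
  "star_at_0 S \<longleftrightarrow> (\<forall>z\<in>S. closed_segment 0 z \<subseteq> S)"

lemma star_at_0_triangle:
  assumes "star_at_0 S" "closed_segment x v \<subseteq> S"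
  shows "convex hull {0, x, v} \<subseteq> S"
proof
  fix z assume "z \<in> convex hull {0, x, v}"
  then obtain a b y where "0 \<le> a" "0 \<le> b" "a + b = 1" "y \<in> closed_segment x v" "z = a *\<^sub>R 0 + b *\<^sub>R y"
    by (auto simp: convex_hull_insert[of "{x, v}" 0] segment_convex_hull)
  then have "y \<in> S" "z \<in> closed_segment 0 y"
    using assms(2) by (blast, auto simp: in_segment intro!: exI[of _ b])
  then show "z \<in> S" using assms(1) by (auto simp: star_at_0_def)
qed

text \<open>Divided by \<open>cross2 x v\<close>, the two nonnegative quantities are the coordinates
  of \<open>z\<close> in the basis \<open>x\<close>, \<open>v\<close>. The last inequality places
  \<open>z\<close> on the near side of the line \<open>xv\<close>.\<close>

lemma star_at_0_triangle_cross2: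
  assumes "star_at_0 S" "closed_segment x v \<subseteq> S" "cross2 x v > 0"
    "cross2 z v \<ge> 0" "cross2 x z \<ge> 0" "cross2 z v + cross2 x z \<le> cross2 x v"
  shows "z \<in> S"
proof -
  define a where "a = cross2 z v / cross2 x v"
  define b where "b = cross2 x z / cross2 x v"
  have "z = a *\<^sub>R x + b *\<^sub>R v"
    unfolding a_def b_def using assms by (intro cross2_cramer) auto
  moreover have "a \<ge> 0" "b \<ge> 0" using assms by (auto simp: a_def b_def)
  moreover have "a + b \<le> 1" using assms by (simp add: a_def b_def flip: add_divide_distrib)
  ultimately have "z \<in> convex hull {0, x, v}"
    unfolding convex_hull_3
    by (intro CollectI exI[of _ "1 - a - b"] exI[of _ a] exI[of _ b]) auto
  then show ?thesis using star_at_0_triangle[OF assms(1,2)] by blast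
qed

text \<open>The segment is covered by the two radial segments from \<open>0\<close> to
  \<open>p\<close> and to \<open>q\<close>.\<close>

lemma star_at_0_collinear:
  assumes star: "star_at_0 S" and S: "p \<in> S" "q \<in> S" and "cross2 p q = 0" "p \<noteq> 0"
  shows "closed_segment p q \<subseteq> S"
proof
  fix z assume "z \<in> closed_segment p q"
  then obtain s where s: "0 \<le> s" "s \<le> 1" "z = (1 - s) *\<^sub>R p + s *\<^sub>R q"
    by (auto simp: in_segment)
  obtain c where c: "q = c *\<^sub>R p"
  proof -
    have "Re p * Im q = Im p * Re q" using assms(4) by (simp add: cross2_def)
    then have "q = (if Re p = 0 then Im q / Im p else Re q / Re p) *\<^sub>R p"
      using \<open>p \<noteq> 0\<close> by (auto simp: complex_eq_iff field_simps)
    then show ?thesis using that by blast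
  qed
  define m where "m = 1 - s + s * c"
  have z: "z = m *\<^sub>R p" using s c by (simp add: m_def algebra_simps)
  have 0: "closed_segment 0 p \<subseteq> S" "closed_segment 0 q \<subseteq> S" using star S by (auto simp: star_at_0_def)
  show "z \<in> S"
  proof (cases "0 \<le> m \<and> m \<le> 1")
    case True
    then have "z \<in> closed_segment 0 p" using z by (auto simp: in_segment)
    then show ?thesis using 0(1) by blast
  next
    case False
    then consider "m < 0" | "m > 1" by linarith
    \<comment> \<open>Outside the range from \<open>0\<close> to \<open>1\<close>, the coordinate
      \<open>m\<close> lies between \<open>0\<close> and the coordinate \<open>c\<close> of
      \<open>q\<close>.\<close>
    then have "c \<noteq> 0 \<and> 0 \<le> m / c \<and> m / c \<le> 1"
    proof cases
      case 1
      then have "s * c < 0" using s by (simp add: m_def)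
      then have "c < 0" using s by (simp add: mult_less_0_iff)
      moreover have "0 \<le> (1 - s) * (1 - c)" using s \<open>c < 0\<close> by (intro mult_nonneg_nonneg) auto
      then have "c \<le> m" by (simp add: m_def algebra_simps)
      ultimately show ?thesis using 1 by (simp add: divide_simps)
    next
      case 2
      then have "0 < s * (c - 1)" by (simp add: m_def algebra_simps)
      then have "c > 1" using s by (simp add: zero_less_mult_iff)
      moreover have "0 \<le> (1 - s) * (c - 1)" using s \<open>c > 1\<close> by (intro mult_nonneg_nonneg) auto
      then have "m \<le> c" by (simp add: m_def algebra_simps)
      ultimately show ?thesis using 2 by (simp add: divide_simps)
    qed
    then have "z \<in> closed_segment 0 q" using z c by (auto simp: in_segment intro!: exI[of _ "m / c"])
    then show ?thesis using 0(2) by blast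
  qed
qed

text \<open>The open triangle \<open>0xv\<close> is an open subset of \<open>S\<close>, hence part
  of its interior, so it cannot contain \<open>u\<close>.\<close>

lemma frontier_point_beyond_segment:
  assumes "star_at_0 S" "closed_segment x v \<subseteq> S" "cross2 x v > 0"
    "cross2 u v > 0" "cross2 x u > 0" "u \<notin> interior S"
  shows "cross2 x v \<le> cross2 u v + cross2 x u"
proof (rule ccontr)
  assume less: "\<not> ?thesis"
  let ?W = "{z. 0 < cross2 z v} \<inter> {z. 0 < cross2 x z} \<inter> {z. cross2 z v + cross2 x z < cross2 x v}"
  have "open ?W" unfolding cross2_def
    by (intro open_Int open_Collect_less continuous_intros)
  moreover have "?W \<subseteq> S"
    using star_at_0_triangle_cross2[OF assms(1-3)] by auto
  ultimately have "?W \<subseteq> interior S" by (simp add: interior_maximal)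
  then show False using less assms by auto
qed

lemma star_at_0_crossing_strict:
  assumes star: "star_at_0 S" and S: "closed_segment x v \<subseteq> S" "closed_segment u w \<subseteq> S"
    and int: "u \<notin> interior S" "v \<notin> interior S"
    and pos: "cross2 x u > 0" "cross2 u v > 0" "cross2 v w > 0"
      "cross2 x v > 0" "cross2 u w > 0" "cross2 x w > 0"
  shows "closed_segment x w \<subseteq> S"
proof
  fix z assume "z \<in> closed_segment x w"
  then obtain s where s: "0 \<le> s" "s \<le> 1" "z = (1 - s) *\<^sub>R x + s *\<^sub>R w"
    by (auto simp: in_segment)
  have u: "cross2 x v \<le> cross2 u v + cross2 x u"
    using frontier_point_beyond_segment star S int pos by blast
  have v: "cross2 u w \<le> cross2 v w + cross2 u v"
    using frontier_point_beyond_segment star S int pos by blast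
  \<comment> \<open>\<open>w\<close> is on the near side of the line \<open>xv\<close>, and \<open>x\<close> on the near side of the line \<open>uw\<close>.\<close>
  have w: "cross2 w v + cross2 x w \<le> cross2 x v"
  proof -
    \<comment> \<open>The three-term Pluecker relation for \<open>u, v, x, w\<close>. It reappears
      below for \<open>x\<close> and, with \<open>z\<close> in place of \<open>x\<close>, for the
      sign of \<open>cross2 u z\<close>.\<close>
    have "cross2 u v * (cross2 w v + cross2 x w)
        = cross2 u w * cross2 x v - cross2 v w * (cross2 u v + cross2 x u)"
      by (simp add: cross2_def algebra_simps)
    also have "\<dots> \<le> (cross2 v w + cross2 u v) * cross2 x v - cross2 v w * cross2 x v"
      using u v pos by (intro diff_mono mult_right_mono mult_left_mono) auto
    also have "\<dots> = cross2 u v * cross2 x v" by (simp add: algebra_simps)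
    finally show ?thesis using pos by simp
  qed
  have x: "cross2 x w + cross2 u x \<le> cross2 u w"
  proof -
    have "cross2 u v * (cross2 x w + cross2 u x)
        = cross2 x v * cross2 u w - cross2 x u * (cross2 v w + cross2 u v)"
      by (simp add: cross2_def algebra_simps)
    also have "\<dots> \<le> (cross2 u v + cross2 x u) * cross2 u w - cross2 x u * cross2 u w"
      using u v pos by (intro diff_mono mult_right_mono mult_left_mono) auto
    also have "\<dots> = cross2 u v * cross2 u w" by (simp add: algebra_simps)
    finally show ?thesis using pos by simp
  qed
  have zx: "cross2 x z = s * cross2 x w" and zw: "cross2 z w = (1 - s) * cross2 x w"
    and zv: "cross2 z v = (1 - s) * cross2 x v + s * cross2 w v"
    and uz: "cross2 u z = (1 - s) * cross2 u x + s * cross2 u w"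
    unfolding s(3) by (simp_all add: cross2_def algebra_simps)
  show "z \<in> S"
  \<comment> \<open>The ray through \<open>v\<close> splits \<open>xw\<close>: the part on the side
    of \<open>x\<close> lies in the triangle \<open>0xv\<close>, the rest in the triangle
    \<open>0uw\<close>.\<close>
  proof (cases "cross2 z v \<ge> 0")
    case True
    have "cross2 z v + cross2 x z = (1 - s) * cross2 x v + s * (cross2 w v + cross2 x w)"
      by (simp add: zv zx algebra_simps)
    also have "\<dots> \<le> (1 - s) * cross2 x v + s * cross2 x v"
      using w s by (intro add_mono mult_left_mono) auto
    finally have "cross2 z v + cross2 x z \<le> cross2 x v" by (simp add: algebra_simps)
    then show ?thesis
      using star_at_0_triangle_cross2[OF star S(1) pos(4) True] zx s pos by simp
  next
    case False
    have "cross2 z w + cross2 u z = (1 - s) * (cross2 x w + cross2 u x) + s * cross2 u w"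
      by (simp add: uz zw algebra_simps)
    also have "\<dots> \<le> (1 - s) * cross2 u w + s * cross2 u w"
      using x s by (intro add_mono mult_left_mono) auto
    finally have "cross2 z w + cross2 u z \<le> cross2 u w" by (simp add: algebra_simps)
    moreover have "cross2 u z \<ge> 0"
    proof -
      have "cross2 u z * cross2 v w = cross2 u v * cross2 z w + cross2 u w * (- cross2 z v)"
        by (simp add: cross2_def algebra_simps)
      also have "\<dots> \<ge> 0" using False pos zw s by (intro add_nonneg_nonneg mult_nonneg_nonneg) auto
      finally show ?thesis using pos by (simp add: zero_le_mult_iff)
    qed
    ultimately show ?thesis
      using star_at_0_triangle_cross2[OF star S(2) pos(5)] zw s pos by simp
  qed
qed

text \<open>Adds the cases of two points on one ray. If \<open>x\<close> is on the segment from
  \<open>0\<close> to \<open>u\<close>, then \<open>xw\<close> stays in the triangle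
  \<open>0uw\<close>; if \<open>w\<close> is on the segment from \<open>0\<close> to
  \<open>v\<close>, then \<open>xw\<close> stays in the triangle \<open>0xv\<close>.\<close>

lemma star_at_0_crossing:
  assumes star: "star_at_0 S" and S: "closed_segment x v \<subseteq> S" "closed_segment u w \<subseteq> S"
    and int: "u \<notin> interior S" "v \<notin> interior S"
    and pos: "cross2 u v > 0" "cross2 x v > 0" "cross2 u w > 0" "cross2 x w > 0"
    and xu: "cross2 x u > 0 \<or> x \<in> closed_segment 0 u"
    and vw: "cross2 v w > 0 \<or> w \<in> closed_segment 0 v"
  shows "closed_segment x w \<subseteq> S"
proof -
  have hull: "closed_segment a b \<subseteq> S"
    if "closed_segment p q \<subseteq> S" "a \<in> convex hull {0, p, q}" "b \<in> convex hull {0, p, q}" for a b p q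
  proof -
    have "closed_segment a b \<subseteq> convex hull {0, p, q}"
      using that by (simp add: closed_segment_subset)
    then show ?thesis using star_at_0_triangle[OF star that(1)] by blast
  qed
  have seg: "closed_segment 0 p \<subseteq> convex hull {0, p, q}"
    "closed_segment 0 q \<subseteq> convex hull {0, p, q}" for p q :: complex
    by (auto simp: segment_convex_hull intro!: hull_mono)
  have mem: "p \<in> convex hull {0, p, q}" "q \<in> convex hull {0, p, q}" for p q :: complex
    by (auto intro: hull_inc)
  consider "x \<in> closed_segment 0 u" | "w \<in> closed_segment 0 v" | "cross2 x u > 0" "cross2 v w > 0"
    using xu vw by blast
  then show ?thesis
  proof cases
    case 1
    then show ?thesis using hull[OF S(2)] seg mem by blast
  next
    case 2
    then show ?thesis using hull[OF S(1)] seg mem by blast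
  next
    case 3
    then show ?thesis using star_at_0_crossing_strict star S int pos by blast
  qed
qed


section \<open>Angular order and the count of visible pairs\<close>

lemma ex_small_perturbation:
  fixes k r :: "'a \<Rightarrow> real"
  assumes "finite V"
  shows "\<exists>e>0. \<forall>p\<in>V. \<forall>q\<in>V. k p < k q \<longrightarrow> k p + e * (r p + r q) < k q"
proof -
  have "\<forall>\<^sub>F e in at_right 0. k p < k q \<longrightarrow> k p + e * (r p + r q) < k q" for p q
  proof (cases "k p < k q")
    case True
    have "((\<lambda>e. k p + e * (r p + r q)) \<longlongrightarrow> k p + 0 * (r p + r q)) (at_right 0)"
      by (intro tendsto_intros)
    then show ?thesis using True by (auto dest: order_tendstoD(2))
  qed simp
  then have "\<forall>\<^sub>F e in at_right 0. \<forall>p\<in>V. \<forall>q\<in>V. k p < k q \<longrightarrow> k p + e * (r p + r q) < k q"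
    using assms by (simp add: eventually_ball_finite_distrib)
  then have "\<forall>\<^sub>F e in at_right 0. e > 0 \<and> (\<forall>p\<in>V. \<forall>q\<in>V. k p < k q \<longrightarrow> k p + e * (r p + r q) < k q)"
    using eventually_at_right_less[of "0::real"] by eventually_elim auto
  then show ?thesis by (rule eventually_happens'[rotated]) simp
qed

text \<open>An argument of at least \<open>pi\<close> is lowered by \<open>pi\<close> and the radius
  negated.\<close>

lemma ex_line_polar:
  "\<exists>r a. z = rcis r a \<and> 0 \<le> a \<and> a < pi"
proof (cases "Arg2pi z < pi")
  case True
  then show ?thesis
    using Arg2pi_eq[of z] Arg2pi_ge_0[of z] by (auto simp: rcis_def cis_conv_exp)
next
  case False
  have "z = rcis (- cmod z) (Arg2pi z - pi)"
    using Arg2pi_eq[of z] by (simp add: rcis_def cis_conv_exp exp_diff algebra_simps)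
  then show ?thesis using False Arg2pi_lt_2pi[of z] by force
qed

text \<open>A point is \<open>rcis (r p) (k p)\<close> with a signed radius \<open>r p\<close> and the direction \<open>k p\<close> of the line
  through the centre, so that the sign of \<open>r p\<close> tells in which half-plane it lies. Several points
  can lie on one ray, because the centre may be on the line spanned by an edge of the polygon; such
  ties are broken by the small multiple \<open>e\<close> of the distance, upwards for
  the first and downwards for the second point of an edge.\<close>

locale star_points =
  fixes S V :: "complex set" and k r :: "complex \<Rightarrow> real" and e :: real and t :: nat
  assumes star: "star_at_0 S" and finV: "finite V" and not_interior: "V \<inter> interior S = {}"
    and polar: "p \<in> V \<Longrightarrow> p = rcis (r p) (k p)" and r_nz: "p \<in> V \<Longrightarrow> r p \<noteq> 0"
    and k_ge: "p \<in> V \<Longrightarrow> 0 \<le> k p" and k_less: "p \<in> V \<Longrightarrow> k p < pi"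
    and e_pos: "e > 0"
    and e_small: "p \<in> V \<Longrightarrow> q \<in> V \<Longrightarrow> k p < k q \<Longrightarrow> k p + e * (\<bar>r p\<bar> + \<bar>r q\<bar>) < k q"
    and t_pos: "t > 0"
    and free: "biclique_free t {(p, q) \<in> V \<times> V. p \<noteq> q \<and> closed_segment p q \<subseteq> S}"
begin

definition src :: "complex \<Rightarrow> real" where "src p = k p + e * \<bar>r p\<bar>"

definition tgt :: "complex \<Rightarrow> real" where "tgt p = k p - e * \<bar>r p\<bar>"

lemma cross2_eq:
  assumes "p \<in> V" "q \<in> V"
  shows "cross2 p q = r p * r q * sin (k q - k p)"
  using polar[OF assms(1)] polar[OF assms(2)] cross2_rcis by metis

lemma sin_diff_pos_iff:
  assumes "p \<in> V" "q \<in> V"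
  shows "sin (k q - k p) > 0 \<longleftrightarrow> k p < k q"
proof
  assume "k p < k q"
  then show "sin (k q - k p) > 0"
    using k_ge[OF assms(1)] k_less[OF assms(2)] by (intro sin_gt_zero) auto
next
  assume pos: "sin (k q - k p) > 0"
  show "k p < k q"
  proof (rule ccontr)
    assume "\<not> k p < k q"
    then have "sin (k p - k q) \<ge> 0"
      using k_ge[OF assms(2)] k_less[OF assms(1)] by (intro sin_ge_zero) auto
    moreover have "sin (k q - k p) = - sin (k p - k q)" by (metis minus_diff_eq sin_minus)
    ultimately show False using pos by simp
  qed
qed

lemma cross2_pos_same:
  assumes "p \<in> V" "q \<in> V" "r p * r q > 0"
  shows "cross2 p q > 0 \<longleftrightarrow> k p < k q"
  using assms(3) sin_diff_pos_iff[OF assms(1,2)]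
  by (simp add: cross2_eq[OF assms(1,2)] zero_less_mult_iff[of "r p * r q"])

text \<open>Reflecting one of the points in the centre keeps its line but changes the sign of
  \<open>cross2\<close>, which reverses the order of directions.\<close>

lemma cross2_pos_opposite:
  assumes "p \<in> V" "q \<in> V" "r p * r q < 0"
  shows "cross2 p q > 0 \<longleftrightarrow> k q < k p"
proof -
  have "sin (k q - k p) = - sin (k p - k q)" by (metis minus_diff_eq sin_minus)
  then have "cross2 p q = - (r p * r q) * sin (k p - k q)" using assms by (simp add: cross2_eq)
  then show ?thesis
    using assms(3) sin_diff_pos_iff[OF assms(2,1)] zero_less_mult_iff[of "- (r p * r q)" "sin (k p - k q)"]
    by simp
qed

lemma eq_if_polar_eq:
  assumes "p \<in> V" "q \<in> V" "r p * r q > 0" "k p = k q" "\<bar>r p\<bar> = \<bar>r q\<bar>"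
  shows "p = q"
proof -
  have "r p = r q" using assms(3,5) by (auto simp: abs_if zero_less_mult_iff split: if_splits)
  then show ?thesis using polar assms by metis
qed

lemma closed_segment_if_nearer:
  assumes "p \<in> V" "q \<in> V" "r p * r q > 0" "k p = k q" "\<bar>r p\<bar> \<le> \<bar>r q\<bar>"
  shows "p \<in> closed_segment 0 q"
proof -
  have "p = (r p / r q) *\<^sub>R q"
    using polar[OF assms(1)] polar[OF assms(2)] assms(4) r_nz[OF assms(2)]
    by (metis (no_types, lifting) nonzero_eq_divide_eq of_real_mult rcis_def scaleR_conv_of_real mult.assoc)
  moreover have "0 \<le> r p / r q" "r p / r q \<le> 1"
    using assms(3,5) by (auto simp: zero_less_mult_iff divide_simps)
  ultimately show ?thesis by (auto simp: in_segment)
qed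

lemma src_less:
  assumes "p \<in> V" "q \<in> V" "k p < k q"
  shows "src p < src q"
  using e_small[OF assms] e_pos
  by (smt (verit, best) src_def distrib_left mult_nonneg_nonneg abs_ge_zero)

lemma tgt_less:
  assumes "p \<in> V" "q \<in> V" "k p < k q"
  shows "tgt p < tgt q"
  using e_small[OF assms] e_pos
  by (smt (verit, best) tgt_def distrib_left mult_nonneg_nonneg abs_ge_zero)

lemma src_lessD:
  assumes "p \<in> V" "q \<in> V" "r p * r q > 0" "src p < src q"
  shows "k p < k q \<or> k p = k q \<and> p \<in> closed_segment 0 q"
proof -
  have "k p \<le> k q" using src_less[of q p] assms by force
  moreover have "\<bar>r p\<bar> \<le> \<bar>r q\<bar>" if "k p = k q"
    using that assms(4) e_pos by (simp add: src_def)
  ultimately show ?thesis using closed_segment_if_nearer[OF assms(1-3)] by force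
qed

lemma tgt_lessD:
  assumes "p \<in> V" "q \<in> V" "r p * r q > 0" "tgt p < tgt q"
  shows "k p < k q \<or> k p = k q \<and> q \<in> closed_segment 0 p"
proof -
  have "k p \<le> k q" using tgt_less[of q p] assms by force
  moreover have "\<bar>r q\<bar> \<le> \<bar>r p\<bar>" if "k p = k q"
    using that assms(4) e_pos by (simp add: tgt_def)
  ultimately show ?thesis
    using closed_segment_if_nearer[OF assms(2,1)] assms(3) by (force simp: mult.commute)
qed

lemma inj_on_src:
  assumes "A \<subseteq> V" "\<And>p q. p \<in> A \<Longrightarrow> q \<in> A \<Longrightarrow> r p * r q > 0"
  shows "inj_on src A"
proof (rule inj_onI)
  fix p q assume h: "p \<in> A" "q \<in> A" "src p = src q"
  have V: "p \<in> V" "q \<in> V" using h assms by auto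
  have "k p = k q" using src_less[of p q] src_less[of q p] h(3) V by force
  moreover from this have "\<bar>r p\<bar> = \<bar>r q\<bar>" using h(3) e_pos by (simp add: src_def)
  ultimately show "p = q" using eq_if_polar_eq V assms(2) h by blast
qed

lemma inj_on_tgt:
  assumes "A \<subseteq> V" "\<And>p q. p \<in> A \<Longrightarrow> q \<in> A \<Longrightarrow> r p * r q > 0"
  shows "inj_on tgt A"
proof (rule inj_onI)
  fix p q assume h: "p \<in> A" "q \<in> A" "tgt p = tgt q"
  have V: "p \<in> V" "q \<in> V" using h assms by auto
  have "k p = k q" using tgt_less[of p q] tgt_less[of q p] h(3) V by force
  moreover from this have "\<bar>r p\<bar> = \<bar>r q\<bar>" using h(3) e_pos by (simp add: tgt_def)
  ultimately show "p = q" using eq_if_polar_eq V assms(2) h by blast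
qed

text \<open>At equal directions the two perturbations point apart; at unequal directions they are
  too small to change the order.\<close>

lemma tgt_less_src_iff:
  assumes "p \<in> V" "q \<in> V"
  shows "tgt p < src q \<longleftrightarrow> k p \<le> k q"
proof
  assume "k p \<le> k q"
  moreover have "e * \<bar>r p\<bar> > 0" "e * \<bar>r q\<bar> > 0" using e_pos r_nz assms by auto
  ultimately show "tgt p < src q" by (simp add: src_def tgt_def)
next
  assume "tgt p < src q"
  then show "k p \<le> k q"
    using e_small[OF assms(2,1)] by (force simp: src_def tgt_def algebra_simps)
qed

lemma same_side_card_le:
  assumes A: "A \<subseteq> V" "\<And>p q. p \<in> A \<Longrightarrow> q \<in> A \<Longrightarrow> r p * r q > 0"
  shows "card {(p, q) \<in> A \<times> A. cross2 p q > 0 \<and> closed_segment p q \<subseteq> S} \<le> 2 * t * card A"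
proof -
  let ?E = "{(p, q) \<in> A \<times> A. cross2 p q > 0 \<and> closed_segment p q \<subseteq> S}"
  have finA: "finite A" using A finV finite_subset by blast
  have iff: "cross2 p q > 0 \<longleftrightarrow> k p < k q" if "p \<in> A" "q \<in> A" for p q
    using cross2_pos_same A that by blast
  have "card ?E \<le> t * card A + t * card A"
  proof (rule crossing_closed_card_le[OF finA finA inj_on_src[OF A] inj_on_tgt[OF A]])
    show "biclique_free t ?E"
      using A(1) by (intro biclique_free_mono[OF free]) (auto simp: cross2_def)
    fix x u v w assume h: "(x, v) \<in> ?E" "(u, v) \<in> ?E" "(u, w) \<in> ?E" "src x < src u" "tgt v < tgt w"
    have mem: "x \<in> A" "u \<in> A" "v \<in> A" "w \<in> A" using h by auto
    have xu: "k x < k u \<or> k x = k u \<and> x \<in> closed_segment 0 u"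
      using src_lessD A mem h(4) by blast
    have vw: "k v < k w \<or> k v = k w \<and> w \<in> closed_segment 0 v"
      using tgt_lessD A mem h(5) by blast
    have uv: "k u < k v" using h(2) iff mem by blast
    then have xw: "cross2 x w > 0" using xu vw iff mem by auto
    have "closed_segment x w \<subseteq> S"
      using h mem A(1) not_interior xu vw xw iff
      by (intro star_at_0_crossing[OF star, of x v u w]) auto
    then show "(x, w) \<in> ?E" using xw mem by auto
  qed auto
  then show ?thesis by simp
qed

lemma opposite_side_card_le:
  assumes A: "A \<subseteq> V" "\<And>p q. p \<in> A \<Longrightarrow> q \<in> A \<Longrightarrow> r p * r q > 0"
    and B: "B \<subseteq> V" "\<And>p q. p \<in> B \<Longrightarrow> q \<in> B \<Longrightarrow> r p * r q > 0"
    and AB: "\<And>p q. p \<in> A \<Longrightarrow> q \<in> B \<Longrightarrow> r p * r q < 0"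
  shows "card {(p, q) \<in> A \<times> B. cross2 p q > 0 \<and> closed_segment p q \<subseteq> S}
           \<le> t * card B + t * card A + t * t * card B"
proof -
  let ?E = "{(q, p). q \<in> B \<and> p \<in> A \<and> k q \<le> k p \<and> closed_segment p q \<subseteq> S}"
  have fin: "finite A" "finite B" using A B finV finite_subset by blast+
  have iff: "cross2 p q > 0 \<longleftrightarrow> k q < k p" if "p \<in> A" "q \<in> B" for p q
    using cross2_pos_opposite A B AB that by blast
  have iffA: "cross2 p q > 0 \<longleftrightarrow> k p < k q" if "p \<in> A" "q \<in> A" for p q
    using cross2_pos_same A that by blast
  have iffB: "cross2 p q > 0 \<longleftrightarrow> k p < k q" if "p \<in> B" "q \<in> B" for p q
    using cross2_pos_same B that by blast
  have cardE: "card ?E \<le> t * card B + t * card A + t * t * card B"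
  proof (rule hook_graph_card_le[OF fin(2,1) inj_on_tgt[OF B] inj_on_src[OF A]])
    show "?E \<subseteq> B \<times> A" by auto
    show "tgt b < src c" if "(b, c) \<in> ?E" for b c
      using that A(1) B(1) tgt_less_src_iff by auto
    have "?E \<subseteq> {(p, q) \<in> V \<times> V. p \<noteq> q \<and> closed_segment p q \<subseteq> S}"
    proof (intro subrelI CollectI case_prodI conjI SigmaI)
      fix q p assume "(q, p) \<in> ?E"
      then have h: "q \<in> B" "p \<in> A" "closed_segment p q \<subseteq> S" by auto
      then show "q \<in> V" "p \<in> V" "closed_segment q p \<subseteq> S"
        using A(1) B(1) by (auto simp: closed_segment_commute)
      show "q \<noteq> p" using AB[OF h(2,1)] B(2)[OF h(1,1)] by auto
    qed
    then show "biclique_free t ?E" by (rule biclique_free_mono[OF free])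
    show "t > 0" by (rule t_pos)
    fix a b c d assume h: "(a, c) \<in> ?E" "(b, d) \<in> ?E" "tgt a < tgt b" "tgt b < src c" "src c < src d"
    have mem: "a \<in> B" "b \<in> B" "c \<in> A" "d \<in> A" using h by auto
    have inS: "b \<in> S" "c \<in> S" using h by auto
    have le: "k b \<le> k c" using tgt_less_src_iff h(4) mem A(1) B(1) by blast
    have "closed_segment c b \<subseteq> S"
    proof (cases "k b = k c")
      case True
      then have "cross2 c b = 0" using cross2_eq[of c b] mem A(1) B(1) by auto
      moreover have "c \<noteq> 0" using AB[OF mem(3,2)] polar r_nz mem A(1) by (metis rcis_eq_zero_iff subsetD)
      ultimately show ?thesis using star_at_0_collinear[OF star] inS by blast
    next
      case False
      have ab: "k a < k b \<or> k a = k b \<and> b \<in> closed_segment 0 a"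
        using tgt_lessD B mem h(3) by blast
      have cd: "k c < k d \<or> k c = k d \<and> c \<in> closed_segment 0 d"
        using src_lessD A mem h(5) by blast
      \<comment> \<open>The counterclockwise order is \<open>c, d, a, b\<close>, within an angle
        less than \<open>pi\<close>. A tie puts \<open>c\<close> on the segment from
        \<open>0\<close> to \<open>d\<close>, or \<open>b\<close> on the segment from
        \<open>0\<close> to \<open>a\<close>.\<close>
      show ?thesis
        using h mem A(1) B(1) not_interior ab cd iff iffA iffB le False
        by (intro star_at_0_crossing[OF star, of c a d b]) auto
    qed
    then show "(b, c) \<in> ?E" using mem le by simp
  qed
  have "card {(p, q) \<in> A \<times> B. cross2 p q > 0 \<and> closed_segment p q \<subseteq> S} \<le> card (?E\<inverse>)"
  proof (rule card_mono)
    show "finite (?E\<inverse>)" using fin by (auto intro: finite_subset[of _ "B \<times> A"])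
    show "{(p, q) \<in> A \<times> B. cross2 p q > 0 \<and> closed_segment p q \<subseteq> S} \<subseteq> ?E\<inverse>"
      using iff by (force simp: less_imp_le)
  qed
  then show ?thesis using cardE by simp
qed

lemma positive_card_le:
  "card {(p, q) \<in> V \<times> V. cross2 p q > 0 \<and> closed_segment p q \<subseteq> S} \<le> (4 * t + t * t) * card V"
proof -
  let ?F = "\<lambda>A B. {(p, q) \<in> A \<times> B. cross2 p q > 0 \<and> closed_segment p q \<subseteq> S}"
  define P where "P = {p \<in> V. r p > 0}"
  define N where "N = {p \<in> V. r p < 0}"
  have PN: "V = P \<union> N" "P \<inter> N = {}" using r_nz by (fastforce simp: P_def N_def)+
  have fin: "finite P" "finite N" using finV PN by auto
  have finF: "finite (?F A B)" if "finite A" "finite B" for A B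
    using that by (auto intro: finite_subset[of _ "A \<times> B"])
  have P: "P \<subseteq> V" "\<And>p q. p \<in> P \<Longrightarrow> q \<in> P \<Longrightarrow> r p * r q > 0"
    and N: "N \<subseteq> V" "\<And>p q. p \<in> N \<Longrightarrow> q \<in> N \<Longrightarrow> r p * r q > 0"
    and opp: "\<And>p q. p \<in> P \<Longrightarrow> q \<in> N \<Longrightarrow> r p * r q < 0" "\<And>p q. p \<in> N \<Longrightarrow> q \<in> P \<Longrightarrow> r p * r q < 0"
    by (auto simp: P_def N_def mult_pos_pos mult_neg_neg mult_pos_neg mult_neg_pos)
  have cardV: "card V = card P + card N" using card_Un_disjoint fin PN by metis
  have "card (?F V V) \<le> card ((?F P P \<union> ?F N N) \<union> (?F P N \<union> ?F N P))"
    using fin by (intro card_mono finite_UnI finF) (auto simp: PN(1))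
  also have "\<dots> \<le> (card (?F P P) + card (?F N N)) + (card (?F P N) + card (?F N P))"
    by (intro order_trans[OF card_Un_le] add_mono card_Un_le)
  \<comment> \<open>Each point contributes \<open>2 * t\<close> on its own side and
    \<open>t + t + t * t\<close> from the two opposite-side counts.\<close>
  also have "\<dots> \<le> (2 * t * card P + 2 * t * card N) +
      ((t * card N + t * card P + t * t * card N) + (t * card P + t * card N + t * t * card P))"
    by (intro add_mono same_side_card_le opposite_side_card_le P N opp)
  also have "\<dots> = (4 * t + t * t) * card V" by (simp add: cardV algebra_simps)
  finally show ?thesis .
qed

lemma collinear_card_le:
  "card {(p, q) \<in> V \<times> V. cross2 p q = 0 \<and> closed_segment p q \<subseteq> S} \<le> 2 * t * card V"
proof (rule card_le_of_Sigma[OF finV])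
  let ?Q = "\<lambda>p. {q \<in> V \<inter> S. cross2 p q = 0}"
  have nz: "p \<noteq> 0" if "p \<in> V" for p using polar[OF that] r_nz[OF that] by (metis rcis_eq_zero_iff)
  fix p assume p: "p \<in> V"
  have fin: "finite (?Q p)" using finV by simp
  have "card (?Q p) \<le> 2 * t"
  proof (rule ccontr)
    assume many: "\<not> card (?Q p) \<le> 2 * t"
    then obtain X where X: "X \<subseteq> ?Q p" "card X = t"
      using obtain_subset_with_card_n[of t "?Q p"] by auto
    have "finite X" using X fin finite_subset by blast
    then have "t \<le> card (?Q p - X)" using X many by (simp add: card_Diff_subset)
    moreover have "(x, y) \<in> {(p, q) \<in> V \<times> V. p \<noteq> q \<and> closed_segment p q \<subseteq> S}"
      if x: "x \<in> X" and y: "y \<in> ?Q p - X" for x y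
    proof -
      have xQ: "x \<in> ?Q p" using X x by auto
      \<comment> \<open>As \<open>p\<close> is nonzero, these identities make parallelism to
        \<open>p\<close> transitive.\<close>
      have "Re p * cross2 x y = Re x * cross2 p y - Re y * cross2 p x"
        "Im p * cross2 x y = Im x * cross2 p y - Im y * cross2 p x"
        by (simp_all add: cross2_def algebra_simps)
      then have "cross2 x y = 0" using nz[OF p] xQ y by (auto simp: complex_eq_iff)
      then show ?thesis using star_at_0_collinear[OF star] nz xQ y x by auto
    qed
    ultimately show False
      using biclique_freeD[OF free \<open>finite X\<close>, of "?Q p - X"] X fin by blast
  qed
  then show "finite (?Q p) \<and> card (?Q p) \<le> 2 * t" using fin by simp
next
  show "{(p, q) \<in> V \<times> V. cross2 p q = 0 \<and> closed_segment p q \<subseteq> S}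
      \<subseteq> Sigma V (\<lambda>p. {q \<in> V \<inter> S. cross2 p q = 0})"
    by auto
qed

end

text \<open>Swapping a pair negates \<open>cross2\<close>, so the condition
  \<open>cross2 p q \<ge> 0\<close> retains every unordered visible pair in at least one
  order.\<close>

lemma star_at_0_visible_pairs_card_le:
  assumes star: "star_at_0 S" and V: "finite V" "0 \<notin> V" "V \<inter> interior S = {}" and t: "t > 0"
    and free: "biclique_free t {(p, q) \<in> V \<times> V. p \<noteq> q \<and> closed_segment p q \<subseteq> S}"
  shows "card {(p, q) \<in> V \<times> V. cross2 p q \<ge> 0 \<and> closed_segment p q \<subseteq> S} \<le> (6 * t + t * t) * card V"
proof -
  obtain r k where rk: "\<And>z. z = rcis (r z) (k z) \<and> 0 \<le> k z \<and> k z < pi"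
    using ex_line_polar by metis
  obtain e where e: "e > 0"
    "\<forall>p\<in>V. \<forall>q\<in>V. k p < k q \<longrightarrow> k p + e * (\<bar>r p\<bar> + \<bar>r q\<bar>) < k q"
    using ex_small_perturbation[OF V(1), of k "\<lambda>p. \<bar>r p\<bar>"] by blast
  interpret star_points S V k r e t
  proof
    show "r p \<noteq> 0" if "p \<in> V" for p
      using rk[of p] that V(2) by (metis rcis_zero_mod)
  qed (use star V t free rk e in auto)
  let ?F = "\<lambda>R. {(p, q) \<in> V \<times> V. R (cross2 p q) \<and> closed_segment p q \<subseteq> S}"
  have "?F (\<lambda>c. c \<ge> 0) = ?F (\<lambda>c. c > 0) \<union> ?F (\<lambda>c. c = 0)" by auto
  then have "card (?F (\<lambda>c. c \<ge> 0)) \<le> card (?F (\<lambda>c. c > 0)) + card (?F (\<lambda>c. c = 0))"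
    by (simp add: card_Un_le)
  also have "\<dots> \<le> (4 * t + t * t) * card V + 2 * t * card V"
    by (intro add_mono positive_card_le collinear_card_le)
  finally show ?thesis by (simp add: algebra_simps)
qed

section \<open>Transfer to polygons\<close>

lemma pathstart_polygonal_path: "vs \<noteq> [] \<Longrightarrow> pathstart (polygonal_path vs) = hd vs"
  by (induction vs rule: polygonal_path.induct) auto

lemma pathfinish_polygonal_path: "vs \<noteq> [] \<Longrightarrow> pathfinish (polygonal_path vs) = last vs"
  by (induction vs rule: polygonal_path.induct) auto

text \<open>By the Jordan curve theorem every boundary point is a limit of outside points, while the
  interior of the region is open and misses the outside.\<close>

lemma polygon_boundary_not_interior:
  assumes "simple_polygon vs"
  shows "polygon_boundary vs \<inter> interior (polygon_region vs) = {}"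
proof -
  have "vs \<noteq> []" "simple_path (polygon_curve vs)" using assms by (auto simp: simple_polygon_def)
  moreover have "pathfinish (polygon_curve vs) = pathstart (polygon_curve vs)"
    using \<open>vs \<noteq> []\<close>
    by (simp add: polygon_curve_def pathstart_polygonal_path pathfinish_polygonal_path)
  ultimately have fr: "frontier (outside (polygon_boundary vs)) = polygon_boundary vs"
    unfolding polygon_boundary_def using Jordan_inside_outside by blast
  have "interior (polygon_region vs) \<inter> outside (polygon_boundary vs) = {}"
    using interior_subset[of "polygon_region vs"]
    by (auto simp: polygon_region_def outside_inside)
  then have "interior (polygon_region vs) \<inter> closure (outside (polygon_boundary vs)) = {}"
    by (simp add: open_Int_closure_eq_empty)
  then show ?thesis using fr by (auto simp: frontier_def)
qed

text \<open>The centre \<open>c\<close> is translated to the origin. It may itself belong to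
  \<open>V\<close> and has no direction, so it is deleted; its edges account for the summand
  \<open>1\<close>.\<close>

lemma vis_edges_card_le:
  assumes vs: "simple_polygon vs"
    and star: "\<And>q. q \<in> polygon_region vs \<Longrightarrow> sees vs c q"
    and V: "finite V" "V \<subseteq> polygon_boundary vs" and free: "\<not> vis_contains_Ktt vs V t" and t: "t > 0"
  shows "card (vis_edges vs V) \<le> (1 + 6 * t + t * t) * card V"
proof -
  define S where "S = (\<lambda>z. - c + z) ` polygon_region vs"
  define W where "W = (\<lambda>z. - c + z) ` (V - {c})"
  let ?D = "{(p, q) \<in> W \<times> W. cross2 p q \<ge> 0 \<and> closed_segment p q \<subseteq> S}"
  have seg: "closed_segment (- c + p) (- c + q) \<subseteq> S \<longleftrightarrow> sees vs p q" for p q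
  proof -
    have "closed_segment (- c + p) (- c + q) = (\<lambda>z. - c + z) ` closed_segment p q"
      by (rule closed_segment_translation)
    then show ?thesis by (auto simp: S_def sees_def inj_image_subset_iff inj_on_def)
  qed
  have finW: "finite W" using V by (simp add: W_def)
  have "star_at_0 S" unfolding star_at_0_def
  proof
    fix z assume "z \<in> S"
    then obtain q where "q \<in> polygon_region vs" "z = - c + q" by (auto simp: S_def)
    then show "closed_segment 0 z \<subseteq> S" using seg[of c q] star by simp
  qed
  moreover have "W \<inter> interior S = {}"
  proof -
    have "interior S = (\<lambda>z. - c + z) ` interior (polygon_region vs)"
      unfolding S_def by (rule interior_translation)
    moreover have "V \<inter> interior (polygon_region vs) = {}"
      using V(2) polygon_boundary_not_interior[OF vs] by blast
    ultimately show ?thesis by (auto simp: W_def)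
  qed
  moreover have "0 \<notin> W" by (auto simp: W_def)
  moreover have "biclique_free t {(p, q) \<in> W \<times> W. p \<noteq> q \<and> closed_segment p q \<subseteq> S}"
    unfolding biclique_free_def
  proof (safe)
    fix X Y assume h: "t = card X" "card Y = card X"
      "X \<times> Y \<subseteq> {(p, q) \<in> W \<times> W. p \<noteq> q \<and> closed_segment p q \<subseteq> S}"
    \<comment> \<open>Only for nonempty factors does
      \<open>X \<times> Y \<subseteq> W \<times> W\<close> place both factors inside
      \<open>W\<close>.\<close>
    have ne: "X \<noteq> {}" "Y \<noteq> {}" using h t by auto
    let ?A = "(\<lambda>z. c + z) ` X" and ?B = "(\<lambda>z. c + z) ` Y"
    have "X \<subseteq> W" "Y \<subseteq> W" using h(3) ne by blast+
    then have "?A \<subseteq> V" "?B \<subseteq> V" by (auto simp: W_def)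
    moreover have "?A \<inter> ?B = {}" using h(3) by auto
    moreover have "card ?A = t" "card ?B = t" using h by (simp_all add: card_image)
    moreover have "\<forall>a\<in>?A. \<forall>b\<in>?B. sees vs a b"
      using h(3) by (auto simp flip: seg)
    ultimately show False using free unfolding vis_contains_Ktt_def by blast
  qed
  ultimately have D: "card ?D \<le> (6 * t + t * t) * card W"
    using star_at_0_visible_pairs_card_le finW t by blast
  have "vis_edges vs V \<subseteq> (\<lambda>q. {c, q}) ` V \<union> (\<lambda>(p, q). {c + p, c + q}) ` ?D"
  proof
    fix E assume "E \<in> vis_edges vs V"
    then obtain p q where pq: "p \<in> V" "q \<in> V" "sees vs p q" "E = {p, q}"
      by (auto simp: vis_edges_def)
    show "E \<in> (\<lambda>q. {c, q}) ` V \<union> (\<lambda>(p, q). {c + p, c + q}) ` ?D"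
    proof (cases "p = c \<or> q = c")
      case True
      then show ?thesis using pq by auto
    next
      case False
      let ?p = "- c + p" and ?q = "- c + q"
      have W: "?p \<in> W" "?q \<in> W" using pq False by (auto simp: W_def)
      have "closed_segment ?p ?q \<subseteq> S" using pq seg by simp
      moreover have "cross2 ?q ?p = - cross2 ?p ?q" by (simp add: cross2_def algebra_simps)
      ultimately have "(?p, ?q) \<in> ?D \<or> (?q, ?p) \<in> ?D"
        using W by (auto simp: closed_segment_commute)
      then have "E \<in> (\<lambda>(p, q). {c + p, c + q}) ` ?D"
      proof
        assume "(?p, ?q) \<in> ?D"
        then show ?thesis by (rule rev_image_eqI) (simp add: pq(4))
      next
        assume "(?q, ?p) \<in> ?D"
        then show ?thesis by (rule rev_image_eqI) (simp add: pq(4) insert_commute)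
      qed
      then show ?thesis by blast
    qed
  qed
  moreover have finD: "finite ?D" using finW by (auto intro: finite_subset[of _ "W \<times> W"])
  ultimately have "card (vis_edges vs V) \<le> card ((\<lambda>q. {c, q}) ` V \<union> (\<lambda>(p, q). {c + p, c + q}) ` ?D)"
    using V(1) by (intro card_mono finite_UnI finite_imageI)
  also have "\<dots> \<le> card ((\<lambda>q. {c, q}) ` V) + card ((\<lambda>(p, q). {c + p, c + q}) ` ?D)"
    by (rule card_Un_le)
  also have "\<dots> \<le> card V + card ?D"
    using V(1) finD by (intro add_mono card_image_le)
  also have "\<dots> \<le> card V + (6 * t + t * t) * card V"
  proof -
    have "card W \<le> card V"
      unfolding W_def using V(1) by (meson card_Diff1_le card_image_le finite_Diff order_trans)
    then show ?thesis using D by (meson add_left_mono mult_le_mono2 order_trans)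
  qed
  finally show ?thesis by (simp add: algebra_simps)
qed

theorem theorem1p2:
  fixes t :: nat
  assumes "t > 0"
  shows "\<exists>C::real. \<forall>(vs::complex list) (V::complex set).
           simple_polygon vs \<and> star_shaped_polygon vs \<and> finite V \<and> V \<subseteq> polygon_boundary vs \<and>
           \<not> vis_contains_Ktt vs V t
           \<longrightarrow> real (card (vis_edges vs V)) \<le> C * real (card V)"
proof (intro exI[of _ "real (1 + 6 * t + t * t)"] allI impI, elim conjE)
  fix vs :: "complex list" and V :: "complex set"
  assume h: "simple_polygon vs" "star_shaped_polygon vs" "finite V" "V \<subseteq> polygon_boundary vs"
    "\<not> vis_contains_Ktt vs V t"
  then obtain c where "\<And>q. q \<in> polygon_region vs \<Longrightarrow> sees vs c q"
    unfolding star_shaped_polygon_def by blast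
  then have "card (vis_edges vs V) \<le> (1 + 6 * t + t * t) * card V"
    using vis_edges_card_le h assms by blast
  then show "real (card (vis_edges vs V)) \<le> real (1 + 6 * t + t * t) * real (card V)"
    by (metis of_nat_le_iff of_nat_mult)
qed

end
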